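(* Let $R$ be an associative ring with identity and $M$ a right $R$-module. The following conditions are equivalent: (1) $M$ is SSP. (2) For any two direct summands $A_1$ and $A_2$ of $M$ with $A_1\simeq A_2$, $A_1+A_2$ is a direct summand of $M$.
   Context: A module $M$ is SSP if the sum of any two direct summands of $M$ is a direct summand of $M$. *)

theory Defs
  imports "HOL-Algebra.Algebra"
begin

(* The library locale "module" requires a commutative ring of scalars. Here the scalars form an
   arbitrary associative ring with identity (locale "ring") and act from the right. As in the
   library record for modules, the multiplicative fields of M inherited from "ring" are unused. *)

record ('a, 'b) right_module = "'b ring" +
  rsmult :: "['b, 'a] \<Rightarrow> 'b" (infixl \<open>\<triangleleft>\<index>\<close> 70)

locale right_module = R?: ring R + M?: abelian_group M
  for R :: "('a, 'r) ring_scheme" (structure)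
    and M :: "('a, 'b, 'm) right_module_scheme" (structure) +
  assumes rsmult_closed [simp, intro]:
      "\<lbrakk>x \<in> carrier M; a \<in> carrier R\<rbrakk> \<Longrightarrow> x \<triangleleft>\<^bsub>M\<^esub> a \<in> carrier M"
    and rsmult_l_distr:
      "\<lbrakk>x \<in> carrier M; y \<in> carrier M; a \<in> carrier R\<rbrakk> \<Longrightarrow>
        (x \<oplus>\<^bsub>M\<^esub> y) \<triangleleft>\<^bsub>M\<^esub> a = x \<triangleleft>\<^bsub>M\<^esub> a \<oplus>\<^bsub>M\<^esub> y \<triangleleft>\<^bsub>M\<^esub> a"
    and rsmult_r_distr:
      "\<lbrakk>x \<in> carrier M; a \<in> carrier R; b \<in> carrier R\<rbrakk> \<Longrightarrow>
        x \<triangleleft>\<^bsub>M\<^esub> (a \<oplus>\<^bsub>R\<^esub> b) = x \<triangleleft>\<^bsub>M\<^esub> a \<oplus>\<^bsub>M\<^esub> x \<triangleleft>\<^bsub>M\<^esub> b"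
    and rsmult_assoc:
      "\<lbrakk>x \<in> carrier M; a \<in> carrier R; b \<in> carrier R\<rbrakk> \<Longrightarrow>
        x \<triangleleft>\<^bsub>M\<^esub> (a \<otimes>\<^bsub>R\<^esub> b) = (x \<triangleleft>\<^bsub>M\<^esub> a) \<triangleleft>\<^bsub>M\<^esub> b"
    and rsmult_one [simp]:
      "x \<in> carrier M \<Longrightarrow> x \<triangleleft>\<^bsub>M\<^esub> \<one>\<^bsub>R\<^esub> = x"

locale right_submodule = additive_subgroup N M
  for N and R :: "('a, 'r) ring_scheme"
    and M :: "('a, 'b, 'm) right_module_scheme" (structure) +
  assumes rsmult_mem: "\<lbrakk>x \<in> N; a \<in> carrier R\<rbrakk> \<Longrightarrow> x \<triangleleft>\<^bsub>M\<^esub> a \<in> N"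

lemma (in right_module) right_submodule_is_right_module:
  assumes "right_submodule N R M"
  shows "right_module R (M\<lparr>carrier := N\<rparr>)"
proof -
  interpret N: right_submodule N R M by fact
  have "abelian_group (M\<lparr>carrier := N\<rparr>)"
  proof (rule abelian_groupI)
    fix x assume "x \<in> carrier (M\<lparr>carrier := N\<rparr>)"
    then have "x \<in> N" by simp
    then have "\<ominus>\<^bsub>M\<^esub> x \<in> N" "\<ominus>\<^bsub>M\<^esub> x \<oplus>\<^bsub>M\<^esub> x = \<zero>\<^bsub>M\<^esub>"
      using N.a_subset by (auto intro: M.l_neg)
    then show "\<exists>y\<in>carrier (M\<lparr>carrier := N\<rparr>). y \<oplus>\<^bsub>M\<lparr>carrier := N\<rparr>\<^esub> x = \<zero>\<^bsub>M\<lparr>carrier := N\<rparr>\<^esub>"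
      by auto
  qed (use N.a_subset in \<open>auto simp: subset_iff M.a_ac\<close>)
  then show ?thesis
    by (intro right_module.intro right_module_axioms.intro)
       (use N.a_subset in \<open>auto simp: R.ring_axioms N.rsmult_mem subset_iff
          rsmult_l_distr rsmult_r_distr rsmult_assoc\<close>)
qed

definition right_module_hom ::
  "('a, 'r) ring_scheme \<Rightarrow> ('a, 'b, 'm) right_module_scheme \<Rightarrow> ('a, 'c, 'n) right_module_scheme
    \<Rightarrow> ('b \<Rightarrow> 'c) set"
  where "right_module_hom R M N =
    {h. h \<in> carrier M \<rightarrow> carrier N \<and>
        (\<forall>x\<in>carrier M. \<forall>y\<in>carrier M. h (x \<oplus>\<^bsub>M\<^esub> y) = h x \<oplus>\<^bsub>N\<^esub> h y) \<and>
        (\<forall>x\<in>carrier M. \<forall>a\<in>carrier R. h (x \<triangleleft>\<^bsub>M\<^esub> a) = h x \<triangleleft>\<^bsub>N\<^esub> a)}"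

definition right_module_iso ::
  "('a, 'r) ring_scheme \<Rightarrow> ('a, 'b, 'm) right_module_scheme \<Rightarrow> ('a, 'c, 'n) right_module_scheme
    \<Rightarrow> ('b \<Rightarrow> 'c) set"
  where "right_module_iso R M N =
    {h \<in> right_module_hom R M N. bij_betw h (carrier M) (carrier N)}"

definition right_module_isomorphic ::
  "('a, 'r) ring_scheme \<Rightarrow> ('a, 'b, 'm) right_module_scheme \<Rightarrow> ('a, 'c, 'n) right_module_scheme
    \<Rightarrow> bool"
  where "right_module_isomorphic R M N \<longleftrightarrow> right_module_iso R M N \<noteq> {}"

definition direct_summand ::
  "('a, 'r) ring_scheme \<Rightarrow> ('a, 'b, 'm) right_module_scheme \<Rightarrow> 'b set \<Rightarrow> bool"
  where "direct_summand R M A \<longleftrightarrow>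
    right_submodule A R M \<and>
    (\<exists>B. right_submodule B R M \<and> A <+>\<^bsub>M\<^esub> B = carrier M \<and> A \<inter> B = {\<zero>\<^bsub>M\<^esub>})"

definition SSP :: "('a, 'r) ring_scheme \<Rightarrow> ('a, 'b, 'm) right_module_scheme \<Rightarrow> bool"
  where "SSP R M \<longleftrightarrow>
    (\<forall>A B. direct_summand R M A \<longrightarrow> direct_summand R M B \<longrightarrow> direct_summand R M (A <+>\<^bsub>M\<^esub> B))"

end

theory Submission
  imports Defs
begin

(* Direct summands are the images of idempotent endomorphisms. For idempotents e and f, the map
   g = e + (1 - e) f e is an idempotent whose image is isomorphic to that of e, so (2) makes
   eM + gM = eM + feM = feM \<oplus> (1 - f)eM a direct summand, and hence also its summand feM.
   Applied to 1 - e and f in place of f and e this gives that (1 - e)fM is a direct summand of M;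
   it lies in (1 - e)M, so eM + fM = eM \<oplus> (1 - e)fM is a direct summand as well. *)

text \<open>Mapping the carrier into \<open>A\<close> and fixing \<open>A\<close> pointwise encode
  together that \<open>e\<close> is idempotent and has image exactly \<open>A\<close>. Values of
  \<open>e\<close> outside the carrier are unconstrained, so no restriction of functions is needed
  when endomorphisms are composed or added.\<close>

definition summand_projection ::
  "('a, 'r) ring_scheme \<Rightarrow> ('a, 'b, 'm) right_module_scheme \<Rightarrow> ('b \<Rightarrow> 'b) \<Rightarrow> 'b set \<Rightarrow> bool"
  where "summand_projection R M e A \<longleftrightarrow>
    e \<in> right_module_hom R M M \<and> A \<subseteq> carrier M \<and> e \<in> carrier M \<rightarrow> A \<and> (\<forall>x\<in>A. e x = x)"

context right_module
begin

section \<open>Differences and scalar multiplication in a right module\<close>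

lemma zero_rsmult: "a \<in> carrier R \<Longrightarrow> \<zero>\<^bsub>M\<^esub> \<triangleleft>\<^bsub>M\<^esub> a = \<zero>\<^bsub>M\<^esub>"
  using rsmult_l_distr[of "\<zero>\<^bsub>M\<^esub>" "\<zero>\<^bsub>M\<^esub>" a] by (simp add: M.add.l_cancel_one)

lemma minus_rsmult:
  assumes "x \<in> carrier M" "a \<in> carrier R"
  shows "(\<ominus>\<^bsub>M\<^esub> x) \<triangleleft>\<^bsub>M\<^esub> a = \<ominus>\<^bsub>M\<^esub> (x \<triangleleft>\<^bsub>M\<^esub> a)"
proof -
  have "(\<ominus>\<^bsub>M\<^esub> x) \<triangleleft>\<^bsub>M\<^esub> a \<oplus>\<^bsub>M\<^esub> x \<triangleleft>\<^bsub>M\<^esub> a = \<zero>\<^bsub>M\<^esub>"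
    using assms by (simp add: rsmult_l_distr[symmetric] M.l_neg zero_rsmult)
  then show ?thesis using assms by (simp add: M.minus_equality)
qed

lemma diff_rsmult:
  "\<lbrakk>x \<in> carrier M; y \<in> carrier M; a \<in> carrier R\<rbrakk> \<Longrightarrow>
    (x \<ominus>\<^bsub>M\<^esub> y) \<triangleleft>\<^bsub>M\<^esub> a = x \<triangleleft>\<^bsub>M\<^esub> a \<ominus>\<^bsub>M\<^esub> y \<triangleleft>\<^bsub>M\<^esub> a"
  by (simp add: M.minus_eq rsmult_l_distr minus_rsmult)

lemma add_diff_add:
  assumes "x \<in> carrier M" "y \<in> carrier M" "u \<in> carrier M" "v \<in> carrier M"
  shows "(x \<oplus>\<^bsub>M\<^esub> y) \<ominus>\<^bsub>M\<^esub> (u \<oplus>\<^bsub>M\<^esub> v) = (x \<ominus>\<^bsub>M\<^esub> u) \<oplus>\<^bsub>M\<^esub> (y \<ominus>\<^bsub>M\<^esub> v)"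
  using assms by (simp add: M.minus_eq M.minus_add M.a_ac)

lemma add_diff_cancel:
  "\<lbrakk>x \<in> carrier M; y \<in> carrier M\<rbrakk> \<Longrightarrow> x \<oplus>\<^bsub>M\<^esub> (y \<ominus>\<^bsub>M\<^esub> x) = y"
  by (simp add: M.minus_eq M.a_lcomm[of x y] M.r_neg)

lemma diff_self: "x \<in> carrier M \<Longrightarrow> x \<ominus>\<^bsub>M\<^esub> x = \<zero>\<^bsub>M\<^esub>"
  by (simp add: M.minus_eq M.r_neg)

lemma diff_zero: "x \<in> carrier M \<Longrightarrow> x \<ominus>\<^bsub>M\<^esub> \<zero>\<^bsub>M\<^esub> = x"
  by (simp add: M.minus_eq)

section \<open>Endomorphisms and their sums, differences and composites\<close>

lemma hom_closed:
  "\<lbrakk>h \<in> right_module_hom R M M; x \<in> carrier M\<rbrakk> \<Longrightarrow> h x \<in> carrier M"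
  by (auto simp: right_module_hom_def)

lemma hom_add:
  "\<lbrakk>h \<in> right_module_hom R M M; x \<in> carrier M; y \<in> carrier M\<rbrakk> \<Longrightarrow>
    h (x \<oplus>\<^bsub>M\<^esub> y) = h x \<oplus>\<^bsub>M\<^esub> h y"
  by (auto simp: right_module_hom_def)

lemma hom_rsmult:
  "\<lbrakk>h \<in> right_module_hom R M M; x \<in> carrier M; a \<in> carrier R\<rbrakk> \<Longrightarrow>
    h (x \<triangleleft>\<^bsub>M\<^esub> a) = h x \<triangleleft>\<^bsub>M\<^esub> a"
  by (auto simp: right_module_hom_def)

lemma hom_zero:
  assumes "h \<in> right_module_hom R M M"
  shows "h \<zero>\<^bsub>M\<^esub> = \<zero>\<^bsub>M\<^esub>"
  using hom_add[OF assms M.zero_closed M.zero_closed] hom_closed[OF assms M.zero_closed]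
  by (simp add: M.add.l_cancel_one)

lemma hom_minus:
  assumes "h \<in> right_module_hom R M M" "x \<in> carrier M"
  shows "h (\<ominus>\<^bsub>M\<^esub> x) = \<ominus>\<^bsub>M\<^esub> h x"
proof -
  have "h (\<ominus>\<^bsub>M\<^esub> x) \<oplus>\<^bsub>M\<^esub> h x = \<zero>\<^bsub>M\<^esub>"
    using assms by (simp add: hom_add[symmetric] M.l_neg hom_zero)
  then show ?thesis using assms by (simp add: M.minus_equality hom_closed)
qed

lemma hom_diff:
  "\<lbrakk>h \<in> right_module_hom R M M; x \<in> carrier M; y \<in> carrier M\<rbrakk> \<Longrightarrow>
    h (x \<ominus>\<^bsub>M\<^esub> y) = h x \<ominus>\<^bsub>M\<^esub> h y"
  by (simp add: M.minus_eq hom_add hom_minus)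

lemma id_hom: "(\<lambda>x. x) \<in> right_module_hom R M M"
  by (auto simp: right_module_hom_def)

lemma comp_hom:
  "\<lbrakk>f \<in> right_module_hom R M M; g \<in> right_module_hom R M M\<rbrakk> \<Longrightarrow>
    (\<lambda>x. f (g x)) \<in> right_module_hom R M M"
  by (auto simp: right_module_hom_def Pi_iff)

lemma add_hom:
  "\<lbrakk>f \<in> right_module_hom R M M; g \<in> right_module_hom R M M\<rbrakk> \<Longrightarrow>
    (\<lambda>x. f x \<oplus>\<^bsub>M\<^esub> g x) \<in> right_module_hom R M M"
  by (auto simp: right_module_hom_def Pi_iff M.a_ac rsmult_l_distr)

lemma diff_hom:
  "\<lbrakk>f \<in> right_module_hom R M M; g \<in> right_module_hom R M M\<rbrakk> \<Longrightarrow>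
    (\<lambda>x. f x \<ominus>\<^bsub>M\<^esub> g x) \<in> right_module_hom R M M"
  by (auto simp: right_module_hom_def Pi_iff add_diff_add diff_rsmult)

section \<open>Submodules and closure under differences\<close>

lemma right_submoduleI:
  assumes "N \<subseteq> carrier M" "\<zero>\<^bsub>M\<^esub> \<in> N"
    and "\<And>x y. \<lbrakk>x \<in> N; y \<in> N\<rbrakk> \<Longrightarrow> x \<ominus>\<^bsub>M\<^esub> y \<in> N"
    and "\<And>x a. \<lbrakk>x \<in> N; a \<in> carrier R\<rbrakk> \<Longrightarrow> x \<triangleleft>\<^bsub>M\<^esub> a \<in> N"
  shows "right_submodule N R M"
proof -
  have neg: "\<ominus>\<^bsub>M\<^esub> x \<in> N" if "x \<in> N" for x
    using assms(1) assms(3)[OF assms(2) that] that by (auto simp: M.minus_eq)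
  have add: "x \<oplus>\<^bsub>M\<^esub> y \<in> N" if "x \<in> N" "y \<in> N" for x y
  proof -
    have "x \<oplus>\<^bsub>M\<^esub> y = x \<ominus>\<^bsub>M\<^esub> (\<ominus>\<^bsub>M\<^esub> y)"
      using that assms(1) by (auto simp: M.minus_eq)
    then show ?thesis using assms(3)[OF that(1) neg[OF that(2)]] by simp
  qed
  have "additive_subgroup N M"
    by (intro additive_subgroupI M.add.subgroupI)
       (use assms neg add in \<open>auto simp: a_inv_def[symmetric]\<close>)
  then show ?thesis
    by (intro right_submodule.intro right_submodule_axioms.intro assms(4))
qed

lemma right_submodule_diff:
  assumes "right_submodule N R M" "x \<in> N" "y \<in> N"
  shows "x \<ominus>\<^bsub>M\<^esub> y \<in> N"
proof -
  interpret N: right_submodule N R M by fact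
  show ?thesis using assms(2,3) N.a_subset by (auto simp: M.minus_eq)
qed

section \<open>Direct summands as images of idempotent endomorphisms\<close>

text \<open>The complement is the kernel of \<open>e\<close>: each \<open>x\<close> splits as
  \<open>e x\<close> plus \<open>x - e x\<close>, and an element both fixed and killed by
  \<open>e\<close> is zero.\<close>

lemma direct_summand_projection:
  assumes "summand_projection R M e A"
  shows "direct_summand R M A"
proof -
  from assms have e: "e \<in> right_module_hom R M M" and AM: "A \<subseteq> carrier M"
    and eA: "\<And>x. x \<in> carrier M \<Longrightarrow> e x \<in> A" and fix_A: "\<And>x. x \<in> A \<Longrightarrow> e x = x"
    by (auto simp: summand_projection_def)
  \<comment> \<open>Seeing \<open>A\<close> as the set of fixed points of \<open>e\<close> reduces
    the submodule conditions to linearity of \<open>e\<close>.\<close>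
  have A_iff: "x \<in> A \<longleftrightarrow> x \<in> carrier M \<and> e x = x" for x
    using AM eA[of x] fix_A by auto
  define B where "B = {x \<in> carrier M. e x = \<zero>\<^bsub>M\<^esub>}"
  have A: "right_submodule A R M"
    by (rule right_submoduleI)
       (auto simp: A_iff hom_zero[OF e] hom_diff[OF e] hom_rsmult[OF e])
  have B: "right_submodule B R M"
    by (rule right_submoduleI)
       (auto simp: B_def hom_zero[OF e] hom_diff[OF e] hom_rsmult[OF e] zero_rsmult diff_self)
  have "A <+>\<^bsub>M\<^esub> B = carrier M"
  proof
    show "A <+>\<^bsub>M\<^esub> B \<subseteq> carrier M"
      using AM by (auto simp: set_add_def' B_def)
    show "carrier M \<subseteq> A <+>\<^bsub>M\<^esub> B"
    proof
      fix x assume x: "x \<in> carrier M"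
      then have ex: "e x \<in> carrier M" by (rule hom_closed[OF e])
      have "x \<ominus>\<^bsub>M\<^esub> e x \<in> B"
        using x ex fix_A[OF eA[OF x]] by (simp add: B_def hom_diff[OF e] diff_self)
      moreover have "x = e x \<oplus>\<^bsub>M\<^esub> (x \<ominus>\<^bsub>M\<^esub> e x)"
        using x ex by (simp add: add_diff_cancel)
      ultimately show "x \<in> A <+>\<^bsub>M\<^esub> B"
        using eA[OF x] by (force simp: set_add_def')
    qed
  qed
  moreover have "A \<inter> B = {\<zero>\<^bsub>M\<^esub>}"
    by (auto simp: A_iff B_def hom_zero[OF e])
  ultimately show ?thesis
    using A B by (auto simp: direct_summand_def)
qed

text \<open>The map is the projection onto \<open>A\<close> along a complement \<open>B\<close>.
  Since \<open>e x\<close> is the only element of \<open>A\<close> that differs from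
  \<open>x\<close> by an element of \<open>B\<close>, each equation for \<open>e\<close> follows by
  checking that its right-hand side has this property.\<close>

lemma direct_summandE:
  assumes "direct_summand R M A"
  obtains e where "summand_projection R M e A"
proof -
  obtain B where A: "right_submodule A R M" and B: "right_submodule B R M"
    and AB: "A <+>\<^bsub>M\<^esub> B = carrier M" and AB0: "A \<inter> B = {\<zero>\<^bsub>M\<^esub>}"
    using assms by (auto simp: direct_summand_def)
  interpret A: right_submodule A R M by fact
  interpret B: right_submodule B R M by fact
  have AM: "x \<in> carrier M" if "x \<in> A" for x using that A.a_subset by auto
  have BM: "x \<in> carrier M" if "x \<in> B" for x using that B.a_subset by auto
  have "\<exists>a. a \<in> A \<and> x \<ominus>\<^bsub>M\<^esub> a \<in> B" if x: "x \<in> carrier M" for x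
  proof -
    from x obtain a b where ab: "a \<in> A" "b \<in> B" "x = a \<oplus>\<^bsub>M\<^esub> b"
      unfolding AB[symmetric] by (auto simp: set_add_def')
    then have "x \<ominus>\<^bsub>M\<^esub> a = b"
      using AM BM by (simp add: M.minus_eq M.a_comm[of a b] M.a_assoc M.r_neg)
    then show ?thesis using ab by auto
  qed
  then obtain e where eA: "\<And>x. x \<in> carrier M \<Longrightarrow> e x \<in> A"
    and eB: "\<And>x. x \<in> carrier M \<Longrightarrow> x \<ominus>\<^bsub>M\<^esub> e x \<in> B"
    by metis
  have uniq: "e x = a" if x: "x \<in> carrier M" and a: "a \<in> A" "x \<ominus>\<^bsub>M\<^esub> a \<in> B" for x a
  proof -
    have ac: "e x \<in> carrier M" "a \<in> carrier M" using AM eA[OF x] a by auto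
    \<comment> \<open>Two remainders in \<open>B\<close> differ by \<open>e x - a\<close>, which
      also lies in \<open>A\<close>; as \<open>A\<close> and \<open>B\<close> meet only in zero, it
      vanishes.\<close>
    have "(x \<ominus>\<^bsub>M\<^esub> a) \<ominus>\<^bsub>M\<^esub> (x \<ominus>\<^bsub>M\<^esub> e x) = (x \<ominus>\<^bsub>M\<^esub> x) \<oplus>\<^bsub>M\<^esub> (e x \<ominus>\<^bsub>M\<^esub> a)"
      using x ac by (simp add: M.minus_eq M.minus_add M.a_ac)
    also have "\<dots> = e x \<ominus>\<^bsub>M\<^esub> a"
      using x ac by (simp add: M.minus_eq M.r_neg)
    finally have "e x \<ominus>\<^bsub>M\<^esub> a \<in> A \<inter> B"
      using right_submodule_diff[OF A eA[OF x] a(1)] right_submodule_diff[OF B a(2) eB[OF x]]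
      by simp
    then have "e x \<ominus>\<^bsub>M\<^esub> a = \<zero>\<^bsub>M\<^esub>" using AB0 by auto
    then show ?thesis using ac add_diff_cancel[of a "e x"] by simp
  qed
  have "e \<in> right_module_hom R M M"
    unfolding right_module_hom_def
  proof (intro CollectI conjI ballI)
    show "e \<in> carrier M \<rightarrow> carrier M" using eA AM by auto
  next
    fix x y assume xy: "x \<in> carrier M" "y \<in> carrier M"
    show "e (x \<oplus>\<^bsub>M\<^esub> y) = e x \<oplus>\<^bsub>M\<^esub> e y"
      by (rule uniq) (use xy eA eB AM in \<open>auto simp: add_diff_add\<close>)
  next
    fix x a assume xa: "x \<in> carrier M" "a \<in> carrier R"
    show "e (x \<triangleleft>\<^bsub>M\<^esub> a) = e x \<triangleleft>\<^bsub>M\<^esub> a"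
      by (rule uniq)
         (use xa eA eB AM in \<open>auto simp: diff_rsmult[symmetric] A.rsmult_mem B.rsmult_mem\<close>)
  qed
  moreover have "e x = x" if "x \<in> A" for x
    by (rule uniq) (use that AM in \<open>auto simp: M.minus_eq M.r_neg\<close>)
  ultimately have "summand_projection R M e A"
    using eA AM by (auto simp: summand_projection_def)
  then show thesis by (rule that)
qed

section \<open>Images of a summand under a projection\<close>

text \<open>Here \<open>iso\<close> is condition (2). It is applied to \<open>A\<close> and an
  isomorphic copy \<open>A'\<close> chosen so that \<open>A + A'\<close> contains \<open>f\<close>
  A\<open>and is mapped into it by\<close>f\<open>. Following a projection onto\<close>A +
  A'\<open>by\<close>f\<open>then gives a projection onto\<close>f \<open>A\<close>.\<close>

lemma direct_summand_image:
  assumes iso: "\<And>A\<^sub>1 A\<^sub>2. \<lbrakk>direct_summand R M A\<^sub>1; direct_summand R M A\<^sub>2;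
      right_module_isomorphic R (M\<lparr>carrier := A\<^sub>1\<rparr>) (M\<lparr>carrier := A\<^sub>2\<rparr>)\<rbrakk> \<Longrightarrow>
      direct_summand R M (A\<^sub>1 <+>\<^bsub>M\<^esub> A\<^sub>2)"
    and pe: "summand_projection R M e A" and pf: "summand_projection R M f B"
  shows "direct_summand R M (f ` A)"
proof -
  from pe have e: "e \<in> right_module_hom R M M" and AM: "\<And>x. x \<in> A \<Longrightarrow> x \<in> carrier M"
    and eA: "\<And>x. x \<in> carrier M \<Longrightarrow> e x \<in> A" and fix_A: "\<And>x. x \<in> A \<Longrightarrow> e x = x"
    by (auto simp: summand_projection_def)
  from pf have f: "f \<in> right_module_hom R M M"
    and ff: "\<And>x. x \<in> carrier M \<Longrightarrow> f (f x) = f x"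
    by (auto simp: summand_projection_def)
  note [simp] = hom_closed[OF e] hom_closed[OF f] AM eA fix_A
  \<comment> \<open>The correction added to \<open>e\<close> is \<open>(1 - e) f e\<close>. It is
    killed by \<open>e\<close> and depends on \<open>x\<close> only through \<open>e x\<close>,
    whence \<open>e g = e\<close> and \<open>g e = g\<close>; these two identities give
    \<open>g g = g e g = g e = g\<close>.\<close>
  define g where "g = (\<lambda>x. e x \<oplus>\<^bsub>M\<^esub> (f (e x) \<ominus>\<^bsub>M\<^esub> e (f (e x))))"
  have g: "g \<in> right_module_hom R M M"
    unfolding g_def
    by (rule add_hom[OF e diff_hom[OF comp_hom[OF f e] comp_hom[OF e comp_hom[OF f e]]]])
  note [simp] = hom_closed[OF g]
  have eg: "e (g x) = e x" if "x \<in> carrier M" for x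
    using that by (simp add: g_def hom_add[OF e] hom_diff[OF e] diff_self)
  have ge: "g (e x) = g x" if "x \<in> carrier M" for x
    using that by (simp add: g_def)
  have gg: "g (g x) = g x" if "x \<in> carrier M" for x
    using that by (metis eg ge hom_closed[OF g])
  define A' where "A' = g ` A"
  have pg: "summand_projection R M g A'"
    unfolding summand_projection_def A'_def
  proof (intro conjI funcsetI ballI g)
    show "g ` A \<subseteq> carrier M" by auto
    \<comment> \<open>By \<open>g e = g\<close>, the values of \<open>g\<close> on the whole module
      are already attained on \<open>A\<close>.\<close>
    show "g x \<in> g ` A" if "x \<in> carrier M" for x
      using ge[OF that] eA[OF that] by (metis imageI)
    show "g x = x" if "x \<in> g ` A" for x
      using that gg by auto
  qed
  \<comment> \<open>On \<open>A\<close> the map \<open>e\<close> is a left inverse of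
    \<open>g\<close>, because \<open>e g = e\<close> and \<open>e\<close> fixes
    \<open>A\<close>.\<close>
  have "bij_betw g A A'"
    unfolding A'_def by (rule inj_on_imp_bij_betw) (metis inj_onI AM eg fix_A)
  then have "g \<in> right_module_iso R (M\<lparr>carrier := A\<rparr>) (M\<lparr>carrier := A'\<rparr>)"
    by (auto simp: right_module_iso_def right_module_hom_def A'_def hom_add[OF g] hom_rsmult[OF g])
  then have "direct_summand R M (A <+>\<^bsub>M\<^esub> A')"
    using direct_summand_projection pe pg
    by (intro iso) (auto simp: right_module_isomorphic_def)
  then obtain h where ph: "summand_projection R M h (A <+>\<^bsub>M\<^esub> A')"
    by (rule direct_summandE)
  then have h: "h \<in> right_module_hom R M M"
    and hS: "\<And>x. x \<in> carrier M \<Longrightarrow> h x \<in> A <+>\<^bsub>M\<^esub> A'"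
    and fix_S: "\<And>x. x \<in> A <+>\<^bsub>M\<^esub> A' \<Longrightarrow> h x = x"
    by (auto simp: summand_projection_def)
  have A: "right_submodule A R M"
    using direct_summand_projection[OF pe] by (simp add: direct_summand_def)
  then interpret A: right_submodule A R M .
  have fA_sub: "f a \<in> A <+>\<^bsub>M\<^esub> A'" if a: "a \<in> A" for a
  proof -
    \<comment> \<open>For \<open>a\<close> in \<open>A\<close> the definition reads
      \<open>g a = a + f a - e (f a)\<close>; this is solved for \<open>f a\<close>, leaving a
      remainder in \<open>A\<close>.\<close>
    have "f a = (e (f a) \<ominus>\<^bsub>M\<^esub> a) \<oplus>\<^bsub>M\<^esub> g a"
    proof -
      have "(e (f a) \<ominus>\<^bsub>M\<^esub> a) \<oplus>\<^bsub>M\<^esub> g a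
          = (a \<oplus>\<^bsub>M\<^esub> \<ominus>\<^bsub>M\<^esub> a) \<oplus>\<^bsub>M\<^esub> ((e (f a) \<oplus>\<^bsub>M\<^esub> \<ominus>\<^bsub>M\<^esub> e (f a)) \<oplus>\<^bsub>M\<^esub> f a)"
        using a by (simp add: g_def M.minus_eq M.a_ac)
      then show ?thesis using a by (simp add: M.r_neg)
    qed
    moreover have "e (f a) \<ominus>\<^bsub>M\<^esub> a \<in> A" using a by (intro right_submodule_diff[OF A]) auto
    moreover have "g a \<in> A'" using a by (auto simp: A'_def)
    ultimately show ?thesis by (auto simp: set_add_def')
  qed
  have f_S: "f s \<in> f ` A" if s: "s \<in> A <+>\<^bsub>M\<^esub> A'" for s
  proof -
    from s obtain a b where a: "a \<in> A" and b: "b \<in> A" and s: "s = a \<oplus>\<^bsub>M\<^esub> g b"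
      by (auto simp: set_add_def' A'_def)
    \<comment> \<open>Since \<open>f f = f\<close>, the value
      \<open>f (g b) = f b + f (f b) - f (e (f b))\<close> equals \<open>f\<close> at
      \<open>b + (b - e (f b))\<close>. This argument lies in \<open>A\<close>, unlike
      \<open>g b\<close> in general.\<close>
    have "f s = f (a \<oplus>\<^bsub>M\<^esub> (b \<oplus>\<^bsub>M\<^esub> (b \<ominus>\<^bsub>M\<^esub> e (f b))))"
      using a b by (simp add: s g_def hom_add[OF f] hom_diff[OF f] ff)
    moreover have "b \<ominus>\<^bsub>M\<^esub> e (f b) \<in> A"
      using b by (intro right_submodule_diff[OF A]) auto
    ultimately show ?thesis using a b by auto
  qed
  \<comment> \<open>Each \<open>f a\<close> lies in \<open>A + A'\<close>, so \<open>h\<close> fixes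
    it, and \<open>f\<close> fixes it by idempotence.\<close>
  have "summand_projection R M (\<lambda>x. f (h x)) (f ` A)"
    using comp_hom[OF f h] f_S hS fA_sub fix_S ff by (auto simp: summand_projection_def)
  then show ?thesis by (rule direct_summand_projection)
qed

section \<open>Sums of two summands\<close>

text \<open>Replacing \<open>B\<close> by its image \<open>?C\<close> under \<open>1 - e\<close>
  leaves the sum with \<open>A\<close> unchanged but makes it direct, as \<open>?C\<close> lies in
  the kernel of \<open>e\<close>. Projections onto \<open>A\<close> and \<open>?C\<close> can then
  be combined into one onto the sum.\<close>

lemma direct_summand_add:
  assumes pe: "summand_projection R M e A" and pf: "summand_projection R M f B"
    and im: "direct_summand R M ((\<lambda>x. x \<ominus>\<^bsub>M\<^esub> e x) ` B)"
  shows "direct_summand R M (A <+>\<^bsub>M\<^esub> B)"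
proof -
  from pe have e: "e \<in> right_module_hom R M M" and AM: "\<And>x. x \<in> A \<Longrightarrow> x \<in> carrier M"
    and eA: "\<And>x. x \<in> carrier M \<Longrightarrow> e x \<in> A" and fix_A: "\<And>x. x \<in> A \<Longrightarrow> e x = x"
    by (auto simp: summand_projection_def)
  from pf have BM: "\<And>x. x \<in> B \<Longrightarrow> x \<in> carrier M"
    by (auto simp: summand_projection_def)
  note [simp] = hom_closed[OF e] AM BM eA fix_A
  have A: "right_submodule A R M"
    using direct_summand_projection[OF pe] by (simp add: direct_summand_def)
  then interpret A: right_submodule A R M .
  let ?C = "(\<lambda>x. x \<ominus>\<^bsub>M\<^esub> e x) ` B"
  obtain q where "summand_projection R M q ?C"
    using im by (rule direct_summandE)
  then have q: "q \<in> right_module_hom R M M"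
    and qC: "\<And>x. x \<in> carrier M \<Longrightarrow> q x \<in> ?C" and fix_C: "\<And>x. x \<in> ?C \<Longrightarrow> q x = x"
    by (auto simp: summand_projection_def)
  have eC: "e c = \<zero>\<^bsub>M\<^esub>" "c \<in> carrier M" if "c \<in> ?C" for c
    using that by (auto simp: hom_diff[OF e] diff_self)
  \<comment> \<open>An element \<open>b\<close> and its image \<open>b - e b\<close> differ by
    \<open>e b\<close>, which the summand \<open>A\<close> absorbs in either direction.\<close>
  have sum_eq: "A <+>\<^bsub>M\<^esub> B = A <+>\<^bsub>M\<^esub> ?C"
  proof (intro equalityI subsetI)
    fix x assume "x \<in> A <+>\<^bsub>M\<^esub> B"
    then obtain a b where ab: "a \<in> A" "b \<in> B" "x = a \<oplus>\<^bsub>M\<^esub> b"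
      by (auto simp: set_add_def')
    then have "x = (a \<oplus>\<^bsub>M\<^esub> e b) \<oplus>\<^bsub>M\<^esub> (b \<ominus>\<^bsub>M\<^esub> e b)"
      by (simp add: M.a_assoc add_diff_cancel)
    moreover have "a \<oplus>\<^bsub>M\<^esub> e b \<in> A"
      using ab by simp
    ultimately show "x \<in> A <+>\<^bsub>M\<^esub> ?C"
      using ab(2) unfolding set_add_def' by blast
  next
    fix x assume "x \<in> A <+>\<^bsub>M\<^esub> ?C"
    then obtain a b where ab: "a \<in> A" "b \<in> B" "x = a \<oplus>\<^bsub>M\<^esub> (b \<ominus>\<^bsub>M\<^esub> e b)"
      by (auto simp: set_add_def')
    then have "x = (a \<ominus>\<^bsub>M\<^esub> e b) \<oplus>\<^bsub>M\<^esub> b"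
      by (simp add: M.minus_eq M.a_ac)
    moreover have "a \<ominus>\<^bsub>M\<^esub> e b \<in> A"
      using ab by (intro right_submodule_diff[OF A]) auto
    ultimately show "x \<in> A <+>\<^bsub>M\<^esub> B"
      using ab(2) unfolding set_add_def' by blast
  qed
  \<comment> \<open>This is \<open>e + q (1 - e)\<close>. Precomposing \<open>q\<close> with
    \<open>1 - e\<close> makes the second term vanish on \<open>A\<close>, where \<open>q\<close>
    itself need not; on \<open>?C\<close> the first term vanishes and the second is the
    identity.\<close>
  define k where "k = (\<lambda>x. e x \<oplus>\<^bsub>M\<^esub> q (x \<ominus>\<^bsub>M\<^esub> e x))"
  have k: "k \<in> right_module_hom R M M"
    unfolding k_def by (rule add_hom[OF e comp_hom[OF q diff_hom[OF id_hom e]]])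
  have "k (a \<oplus>\<^bsub>M\<^esub> c) = a \<oplus>\<^bsub>M\<^esub> c" if a: "a \<in> A" and c: "c \<in> ?C" for a c
  proof -
    have "k a = a"
      using a by (simp add: k_def diff_self hom_zero[OF q])
    moreover have "k c = c"
      using eC[OF c] fix_C[OF c] by (simp add: k_def diff_zero)
    ultimately show ?thesis
      using a eC[OF c] by (simp add: hom_add[OF k])
  qed
  moreover have "k x \<in> A <+>\<^bsub>M\<^esub> ?C" if "x \<in> carrier M" for x
    using eA[OF that] qC[of "x \<ominus>\<^bsub>M\<^esub> e x"] that unfolding set_add_def' k_def
    by (meson UN_I M.minus_closed hom_closed[OF e] singletonI)
  moreover have "A <+>\<^bsub>M\<^esub> ?C \<subseteq> carrier M"
    by (auto simp: set_add_def')
  ultimately have "summand_projection R M k (A <+>\<^bsub>M\<^esub> ?C)"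
    using k by (auto simp: summand_projection_def set_add_def')
  then show ?thesis
    unfolding sum_eq by (rule direct_summand_projection)
qed

text \<open>This makes \<open>1 - e\<close> available as the outer projection in
  \<open>direct_summand_image\<close>.\<close>

lemma summand_projection_complement:
  assumes "summand_projection R M e A"
  shows "summand_projection R M (\<lambda>x. x \<ominus>\<^bsub>M\<^esub> e x) {x \<in> carrier M. e x = \<zero>\<^bsub>M\<^esub>}"
proof -
  from assms have e: "e \<in> right_module_hom R M M"
    and ee: "\<And>x. x \<in> carrier M \<Longrightarrow> e (e x) = e x"
    by (auto simp: summand_projection_def)
  have "(\<lambda>x. x \<ominus>\<^bsub>M\<^esub> e x) \<in> right_module_hom R M M"
    by (intro diff_hom id_hom e)
  then show ?thesis
    by (auto simp: summand_projection_def hom_closed[OF e] hom_diff[OF e] ee diff_self diff_zero)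
qed

end

theorem corollary2p3:
  fixes R :: "('a, 'r) ring_scheme" and M :: "('a, 'b, 'm) right_module_scheme"
  assumes "right_module R M"
  shows "SSP R M \<longleftrightarrow>
    (\<forall>A\<^sub>1 A\<^sub>2. direct_summand R M A\<^sub>1 \<longrightarrow> direct_summand R M A\<^sub>2 \<longrightarrow>
      right_module_isomorphic R (M\<lparr>carrier := A\<^sub>1\<rparr>) (M\<lparr>carrier := A\<^sub>2\<rparr>) \<longrightarrow>
      direct_summand R M (A\<^sub>1 <+>\<^bsub>M\<^esub> A\<^sub>2))"
    (is "_ \<longleftrightarrow> ?iso")
proof
  assume "SSP R M"
  then show ?iso by (simp add: SSP_def)
next
  interpret right_module R M by fact
  assume iso: ?iso
  show "SSP R M"
    unfolding SSP_def
  proof (intro allI impI)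
    fix A B assume "direct_summand R M A" "direct_summand R M B"
    then obtain e f where e: "summand_projection R M e A" and f: "summand_projection R M f B"
      by (meson direct_summandE)
    \<comment> \<open>The image lemma is used with \<open>f\<close> as the projection onto the
      summand \<open>B\<close> and \<open>1 - e\<close> as the map applied to it, which yields
      exactly the image of \<open>B\<close> that \<open>direct_summand_add\<close> asks for.\<close>
    show "direct_summand R M (A <+>\<^bsub>M\<^esub> B)"
      using iso by (intro direct_summand_add[OF e f]
          direct_summand_image[OF _ f summand_projection_complement[OF e]]) blast
  qed
qed

end
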